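(* Let $\{\pi_n\}_{n\ge 0}$ be the polynomials determined by $\pi_0(x)=1$, $\pi_1(x)=x$ and $\pi_{n+1}(x)=(x-n^2)\pi_n(x)-\frac14\pi_{n-1}(x)$ for $n\ge 1$. Let $\delta\in(0,1/2)$ be any fixed small number. For $y$ in a small neighborhood of $[\delta,1-\delta]$ in the complex plane, we have $$\pi_n(n^2y)\sim(-1)^{n-1}\,2\sin(n\pi\sqrt y)\left(\frac{n}{e}\right)^{2n}\left(\frac{1+\sqrt y}{1-\sqrt y}\right)^{n\sqrt y}y^{1/2}(1-y)^{n-1/2}$$ as $n\to\infty$. Precisely: there are an open set $U\subset\mathbb{C}$ containing $[\delta,1-\delta]$ and functions $\varepsilon_n^{(1)},\varepsilon_n^{(2)}:U\to\mathbb{C}$ tending to $0$ uniformly on $U$ as $n\to\infty$ such that, for all $y\in U$ and all $n\ge 1$, $$\pi_n(n^2y)=(-1)^{n-1}\,2\left(\frac{n}{e}\right)^{2n}\left(\frac{1+\sqrt y}{1-\sqrt y}\right)^{n\sqrt y}y^{1/2}(1-y)^{n-1/2}\left[\left(1+\varepsilon_n^{(1)}(y)\right)\sin(n\pi\sqrt y)+\varepsilon_n^{(2)}(y)\cos(n\pi\sqrt y)\right].$$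
   Context: All powers and square roots are principal branches (positive for real $y\in(0,1)$); in particular $\left(\frac{1+\sqrt y}{1-\sqrt y}\right)^{n\sqrt y}=\exp\left\{n\sqrt y\,\log\frac{1+\sqrt y}{1-\sqrt y}\right\}$ with the principal logarithm. *)

theory Defs
  imports "HOL-Analysis.Analysis" "HOL-Computational_Algebra.Polynomial"
begin

text \<open>The case \<open>n + 2\<close> is the recurrence
  \<open>\<pi>\<^sub>m\<^sub>+\<^sub>1(x) = (x - m\<^sup>2) \<pi>\<^sub>m(x) - \<pi>\<^sub>m\<^sub>-\<^sub>1(x)/4\<close> at \<open>m = n + 1\<close>.\<close>

fun pi_poly :: "nat \<Rightarrow> complex poly" where
  "pi_poly 0 = 1"
| "pi_poly (Suc 0) = [:0, 1:]"
| "pi_poly (Suc (Suc n)) =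
     [:- (of_nat (Suc n))\<^sup>2, 1:] * pi_poly (Suc n) - smult (1/4) (pi_poly n)"

text \<open>On complex arguments, \<^const>\<open>csqrt\<close> and \<open>(powr)\<close> are the principal branches:
  \<open>z powr a = exp (a * Ln z)\<close> for \<open>z \<noteq> 0\<close>.\<close>

definition pi_prefactor :: "nat \<Rightarrow> complex \<Rightarrow> complex" where
  "pi_prefactor n y =
     (-1) ^ (n - 1) * 2 * (of_nat n / exp 1) ^ (2 * n)
     * ((1 + csqrt y) / (1 - csqrt y)) powr (of_nat n * csqrt y)
     * y powr (1/2) * (1 - y) powr (of_nat n - 1/2)"

end

theory Submission
  imports Defs "HOL-Real_Asymp.Real_Asymp"
begin

text \<open>Write \<open>y = s\<^sup>2\<close> and \<open>z = n s\<close>.  If the term \<open>1/4\<close> were dropped from the recurrence, \<open>\<pi>\<^sub>n(z\<^sup>2)\<close> would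
be the product of the \<open>z\<^sup>2 - k\<^sup>2 = (z - k) (z + k)\<close> over \<open>k < n\<close>.  Two Pochhammer symbols and
the reflection formula turn this product into
\<open>(-1)\<^sup>n\<^sup>-\<^sup>1 z \<Gamma>(n + z) \<Gamma>(n - z) sin(\<pi> z) / \<pi>\<close> (\<open>prod_square_diff_eq_Gamma_sin\<close>).  Stirling's formula
for the two Gamma values gives exactly the prefactor of the theorem times a factor close to \<open>1\<close>
(\<open>pi_prefactor_conv_Gamma\<close>); it is needed uniformly in a half plane
and is proved here as \<open>complex_stirling\<close>.

The term \<open>1/4\<close> is harmless because at most one factor of the product can be small, namely the one
whose index \<open>m\<close> is the integer nearest to \<open>Re z\<close>; all others are at least a constant times
\<open>n\<close>.  Hence the perturbation changes the product by \<open>O(1/n)\<close> times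
the product without the factor \<open>m\<close>, up to the factor \<open>norm (z\<^sup>2 - m\<^sup>2) + 1\<close>
(\<open>perturbed_product_bound\<close>).  That punctured product is the full one divided by
\<open>z\<^sup>2 - m\<^sup>2\<close>, and the zero of the sine at \<open>m\<close> cancels the division, so it is at most a constant times
the prefactor times \<open>exp (\<pi> \<bar>Im z\<bar>)\<close> (\<open>prod_square_diff_omit_le\<close>).

Since \<open>exp (\<plusminus> \<i> w) = cos w \<plusminus> \<i> sin w\<close>, the exponential is at most
\<open>norm (sin w) + norm (cos w)\<close> for \<open>w = \<pi> z\<close>.  The total error is therefore the prefactor times
\<open>o(1) (norm (sin w) + norm (cos w))\<close>, and any such quantity can be written as
\<open>\<epsilon>1 sin w + \<epsilon>2 cos w\<close> with small coefficients.  The cosine is indispensable: near a zero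
of the sine the error need not vanish.\<close>

section \<open>Stirling's formula in the right half plane\<close>

lemma Ln_mult_Re_pos:
  fixes a b :: complex
  assumes "0 < Re a" "0 < Re b"
  shows "Ln (a * b) = Ln a + Ln b"
proof -
  have "a \<noteq> 0" "b \<noteq> 0" using assms by auto
  then show ?thesis
    using Re_Ln_pos_lt_imp[OF assms(1)] Re_Ln_pos_lt_imp[OF assms(2)]
    by (intro Ln_times_simple) auto
qed

lemma Ln_divide_Re_pos:
  fixes a b :: complex
  assumes "0 < Re a" "0 < Re b"
  shows "Ln (a / b) = Ln a - Ln b"
proof (rule Ln_unique)
  have "a \<noteq> 0" "b \<noteq> 0" using assms by auto
  then show "exp (Ln a - Ln b) = a / b" by (simp add: exp_diff)
qed (use Re_Ln_pos_lt_imp[OF assms(1)] Re_Ln_pos_lt_imp[OF assms(2)] in auto)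

text \<open>The left-hand side is twice the error of the first Taylor approximation of \<open>artanh u\<close>; its
derivative is \<open>2 t\<^sup>2 / (1 - t\<^sup>2)\<close>, which is small of second order.  The absence of a
term in \<open>u\<^sup>2\<close> makes the defect below summable along the shifts \<open>w + k\<close>.\<close>

lemma norm_artanh_remainder_le:
  fixes u :: complex
  assumes "norm u \<le> 1/3"
  shows "norm (Ln (1 + u) - Ln (1 - u) - 2 * u) \<le> 9/4 * norm u ^ 3"
proof -
  define f where "f = (\<lambda>t. Ln (1 + t) - Ln (1 - t) - 2 * t :: complex)"
  define S where "S = cball (0::complex) (norm u)"
  have small: "norm t \<le> norm u" "norm t < 1" "1 + t \<noteq> 0" "1 - t \<noteq> 0" "0 < Re (1 + t)" "0 < Re (1 - t)"
    if "t \<in> S" for t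
  proof -
    show 1: "norm t \<le> norm u" using that by (simp add: S_def)
    then show "norm t < 1" using assms by simp
    then show "0 < Re (1 + t)" "0 < Re (1 - t)"
      using abs_Re_le_cmod[of t] by auto
    then show "1 + t \<noteq> 0" "1 - t \<noteq> 0" by force+
  qed
  have nonpos: "z \<notin> \<real>\<^sub>\<le>\<^sub>0" if "0 < Re z" for z :: complex
    using that by (auto simp: complex_nonpos_Reals_iff)
  have "norm (f u - f 0) \<le> (9/4 * norm u ^ 2) * norm (u - 0)"
  proof (rule field_differentiable_bound[where S = S])
    fix t assume t: "t \<in> S"
    show "(f has_field_derivative (1 / (1 + t) + 1 / (1 - t) - 2)) (at t within S)"
      unfolding f_def using small[OF t] nonpos
      by (auto intro!: derivative_eq_intros simp: divide_inverse)
    have "1 / (1 + t) + 1 / (1 - t) - 2 = 2 * t ^ 2 / (1 - t ^ 2)"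
    proof -
      have "1 / (1 + t) + 1 / (1 - t) - 2 = 2 * t ^ 2 / ((1 + t) * (1 - t))"
        using small(3,4)[OF t] by (simp add: divide_simps) (simp add: algebra_simps power2_eq_square)
      also have "(1 + t) * (1 - t) = 1 - t ^ 2" by (simp add: algebra_simps power2_eq_square)
      finally show ?thesis .
    qed
    moreover have "8 / 9 \<le> norm (1 - t ^ 2)"
    proof -
      have "norm t ^ 2 \<le> (1/3) ^ 2"
        using small(1)[OF t] assms by (intro power_mono) auto
      then have "norm (t ^ 2) \<le> 1 / 9" by (simp add: norm_power power_divide)
      then show ?thesis using norm_triangle_ineq2[of 1 "t ^ 2"] by simp
    qed
    moreover have "norm t ^ 2 \<le> norm u ^ 2" using small(1)[OF t] by (intro power_mono) auto
    ultimately show "norm (1 / (1 + t) + 1 / (1 - t) - 2) \<le> 9/4 * norm u ^ 2"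
    proof -
      assume eq: "1 / (1 + t) + 1 / (1 - t) - 2 = 2 * t ^ 2 / (1 - t ^ 2)"
        and den: "8 / 9 \<le> norm (1 - t ^ 2)" and num: "norm t ^ 2 \<le> norm u ^ 2"
      have "norm (2 * t ^ 2 / (1 - t ^ 2)) = 2 * norm t ^ 2 / norm (1 - t ^ 2)"
        by (simp add: norm_divide norm_mult norm_power)
      also have "\<dots> \<le> 2 * norm u ^ 2 / (8/9)"
        using den num by (intro frac_le) auto
      finally show ?thesis using eq by simp
    qed
  qed (auto simp: S_def)
  then show ?thesis by (simp add: f_def power2_eq_square power3_eq_cube)
qed

text \<open>Replacing \<open>w\<close> by \<open>w + 1\<close> multiplies \<open>exp ((w - 1/2) Ln w - w)\<close> by \<open>w exp (stirling_defect w)\<close>, whereas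
it multiplies \<open>\<Gamma>(w)\<close> by \<open>w\<close>.\<close>

definition stirling_defect :: "complex \<Rightarrow> complex" where
  "stirling_defect w = (w + 1/2) * (Ln (w + 1) - Ln w) - 1"

text \<open>With \<open>u = 1 / (2 w + 1)\<close> the quotient \<open>(w + 1) / w\<close> becomes \<open>(1 + u) / (1 - u)\<close>, so that the defect is
the remainder of \<open>artanh\<close> divided by \<open>2 u\<close>, hence of order \<open>norm u ^ 2\<close>.  The bound is written as a
difference so that it telescopes under \<open>w \<mapsto> w + 1\<close>.\<close>

lemma norm_stirling_defect_le:
  assumes "1 \<le> Re w"
  shows "norm (stirling_defect w) \<le> 1 / Re w - 1 / (Re w + 1)"
proof -
  define u where "u = 1 / (2 * w + 1)"
  have pos: "0 < Re (2 * w + 1)" "0 < Re (2 * w + 2)" "0 < Re (2 * w)" using assms by auto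
  have ne: "2 * w + 1 \<noteq> 0" "w \<noteq> 0" "w + 1 \<noteq> 0" using assms by (auto simp: complex_eq_iff)
  have large: "2 * Re w + 1 \<le> norm (2 * w + 1)"
    using complex_Re_le_cmod[of "2 * w + 1"] by simp
  have u_le: "norm u \<le> 1 / (2 * Re w + 1)"
    unfolding u_def using large assms by (simp add: norm_divide frac_le)
  also have "\<dots> \<le> 1/3" using assms by (simp add: field_simps)
  finally have u3: "norm u \<le> 1/3" .
  have "1 + u = (2 * w + 2) / (2 * w + 1)" "1 - u = 2 * w / (2 * w + 1)"
    using ne by (simp_all add: u_def field_simps)
  then have "Ln (1 + u) - Ln (1 - u) = Ln (2 * w + 2) - Ln (2 * w)"
    using pos by (simp add: Ln_divide_Re_pos)
  also have "\<dots> = Ln (w + 1) - Ln w"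
    using Ln_mult_Re_pos[of 2 "w + 1"] Ln_mult_Re_pos[of 2 w] assms
    by (simp add: algebra_simps)
  finally have diff: "Ln (1 + u) - Ln (1 - u) = Ln (w + 1) - Ln w" .
  have "2 * u * (w + 1/2) = u * (2 * w + 1)" by (simp add: algebra_simps)
  also have "\<dots> = 1" using ne by (simp add: u_def)
  finally have "2 * u * (w + 1/2) = 1" .
  moreover from this have "1 / (2 * u) = w + 1/2"
    by (metis mult_zero_left nonzero_mult_div_cancel_left zero_neq_one)
  ultimately have "stirling_defect w = (Ln (1 + u) - Ln (1 - u) - 2 * u) * (1 / (2 * u))"
    unfolding stirling_defect_def diff by (simp add: algebra_simps)
  then have "norm (stirling_defect w) = norm (Ln (1 + u) - Ln (1 - u) - 2 * u) / (2 * norm u)"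
    by (simp add: norm_mult norm_divide)
  also have "\<dots> \<le> (9/4 * norm u ^ 3) / (2 * norm u)"
    by (intro divide_right_mono norm_artanh_remainder_le u3) auto
  also have "\<dots> = 9/8 * norm u ^ 2"
    using ne by (simp add: u_def power2_eq_square power3_eq_cube)
  also have "\<dots> \<le> 9/8 * (1 / (2 * Re w + 1)) ^ 2"
    using u_le by (intro mult_left_mono power_mono) auto
  also have "\<dots> \<le> 1 / (Re w * (Re w + 1))"
  proof -
    have "9 * (Re w * (Re w + 1)) \<le> 8 * (2 * Re w + 1)^2"
      using assms by (simp add: power2_eq_square algebra_simps)
    have *: "9/8 * (1 / b)^2 \<le> 1 / p" if "9 * p \<le> 8 * b^2" "0 < p" "0 < b" for p b :: real
      using that by (simp add: power_divide field_simps)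
    show ?thesis using assms by (intro * \<open>9 * (Re w * (Re w + 1)) \<le> 8 * (2 * Re w + 1)^2\<close>) auto
  qed
  also have "\<dots> = 1 / Re w - 1 / (Re w + 1)"
    using assms by (simp add: field_simps)
  finally show ?thesis .
qed

definition stirling_ratio :: "complex \<Rightarrow> complex" where
  "stirling_ratio w = Gamma w / exp ((w - 1/2) * Ln w - w)"

lemma Re_pos_not_nonpos_Ints: "0 < Re w \<Longrightarrow> w \<notin> \<int>\<^sub>\<le>\<^sub>0"
  by (auto elim!: nonpos_Ints_cases)

lemma stirling_ratio_plus_1:
  assumes "0 < Re w"
  shows "stirling_ratio w = stirling_ratio (w + 1) * exp (stirling_defect w)"
proof -
  have w0: "w \<noteq> 0" using assms by auto
  have "(w + 1 - 1/2) * Ln (w + 1) - (w + 1) =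
      ((w - 1/2) * Ln w - w) + Ln w + stirling_defect w"
    by (simp add: stirling_defect_def field_simps)
  then have "exp ((w + 1 - 1/2) * Ln (w + 1) - (w + 1)) =
      exp ((w - 1/2) * Ln w - w) * w * exp (stirling_defect w)"
    using w0 by (simp only: exp_add exp_Ln[OF w0])
  moreover have "Gamma (w + 1) = w * Gamma w"
    using assms by (intro Gamma_plus1 Re_pos_not_nonpos_Ints)
  ultimately show ?thesis
    unfolding stirling_ratio_def using w0 by simp
qed

lemma stirling_ratio_shift:
  assumes "0 < Re w"
  shows "stirling_ratio w =
    stirling_ratio (w + of_nat N) * exp (\<Sum>k<N. stirling_defect (w + of_nat k))"
proof (induction N)
  case (Suc N)
  have "stirling_ratio (w + of_nat N) =
      stirling_ratio (w + of_nat N + 1) * exp (stirling_defect (w + of_nat N))"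
    using assms by (intro stirling_ratio_plus_1) simp
  then show ?case using Suc.IH by (simp add: exp_add add_ac mult_ac)
qed simp

lemma norm_sum_stirling_defect_le:
  assumes "1 \<le> Re w"
  shows "norm (\<Sum>k<N. stirling_defect (w + of_nat k)) \<le> 1 / Re w"
proof -
  have "norm (\<Sum>k<N. stirling_defect (w + of_nat k))
      \<le> (\<Sum>k<N. 1 / (Re w + real k) - 1 / (Re w + real (Suc k)))"
    using norm_stirling_defect_le[of "w + of_nat k" for k] assms
    by (intro sum_norm_le) (auto simp: add_ac)
  also have "\<dots> = 1 / Re w - 1 / (Re w + real N)"
    by (subst sum_lessThan_telescope') simp
  also have "\<dots> \<le> 1 / Re w" using assms by simp
  finally show ?thesis .
qed

text \<open>The shifted ratios converge since their logarithmic increments are absolutely summable; only the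
value of the limit requires more work.\<close>

lemma stirling_ratio_nat_convergent:
  obtains K where "(\<lambda>N. stirling_ratio (of_nat (Suc N))) \<longlonglongrightarrow> K" "K \<noteq> 0"
proof -
  have "summable (\<lambda>k. stirling_defect (1 + of_nat k))"
  proof (rule summable_comparison_test')
    have "(\<lambda>k. 1 / (1 + real k)) \<longlonglongrightarrow> 0" by real_asymp
    from telescope_summable'[OF this]
    show "summable (\<lambda>k. 1 / (1 + real k) - 1 / (1 + real (Suc k)))" .
    show "norm (stirling_defect (1 + of_nat k)) \<le> 1 / (1 + real k) - 1 / (1 + real (Suc k))"
      for k using norm_stirling_defect_le[of "1 + of_nat k"] by (simp add: add_ac)
  qed
  then obtain s where s: "(\<lambda>N. \<Sum>k<N. stirling_defect (1 + of_nat k)) \<longlonglongrightarrow> s"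
    by (auto simp: summable_def sums_def)
  have "stirling_ratio (of_nat (Suc N)) =
      stirling_ratio 1 / exp (\<Sum>k<N. stirling_defect (1 + of_nat k))" for N
    using stirling_ratio_shift[of 1 N] by (simp add: add_ac)
  moreover have "(\<lambda>N. stirling_ratio 1 / exp (\<Sum>k<N. stirling_defect (1 + of_nat k)))
      \<longlonglongrightarrow> stirling_ratio 1 / exp s"
    by (intro tendsto_intros s) simp
  ultimately show ?thesis
    using that[of "stirling_ratio 1 / exp s"] by (simp add: stirling_ratio_def)
qed

lemma nat_times_Ln_tendsto:
  fixes w :: complex
  shows "(\<lambda>N. of_nat (Suc N) * Ln (1 + w / of_nat (Suc N))) \<longlonglongrightarrow> w"
proof -
  have "((\<lambda>t. Ln (1 + w * t)) has_field_derivative w) (at 0)"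
    by (auto intro!: derivative_eq_intros)
  then have "((\<lambda>t. Ln (1 + w * t) / t) \<longlongrightarrow> w) (at 0)"
    by (simp add: has_field_derivative_iff)
  moreover have "filterlim (\<lambda>N. 1 / of_nat (Suc N) :: complex) (at 0) sequentially"
    unfolding filterlim_at
    using LIMSEQ_inverse_real_of_nat tendsto_of_real_iff[of "\<lambda>N. inverse (real (Suc N))" 0]
    by (auto simp: divide_inverse simp flip: of_nat_Suc)
  ultimately have "(\<lambda>N. Ln (1 + w * (1 / of_nat (Suc N))) / (1 / of_nat (Suc N))) \<longlonglongrightarrow> w"
    by (rule filterlim_compose)
  then show ?thesis by (simp add: mult.commute)
qed

text \<open>Euler's limit for \<open>\<Gamma>(w)\<close> says that \<open>\<Gamma>(w + N + 1) / \<Gamma>(N + 1)\<close> is asymptotic to \<open>N\<^sup>w\<close>.  The quotient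
of the values of \<open>exp ((v - 1/2) Ln v - v)\<close> at \<open>v = w + N + 1\<close> and \<open>v = N + 1\<close> has the same asymptotics,
so the limit along the integers is also the limit along every translate of them.\<close>

lemma stirling_ratio_translate:
  assumes "0 < Re w" and K: "(\<lambda>N. stirling_ratio (of_nat (Suc N))) \<longlonglongrightarrow> K"
  shows "(\<lambda>N. stirling_ratio (w + of_nat (Suc N))) \<longlonglongrightarrow> K"
proof -
  \<comment> \<open>\<open>D N\<close> is the exponent at \<open>w + N + 1\<close> minus the one at \<open>N + 1\<close> minus \<open>w ln N\<close>.\<close>
  define D where "D = (\<lambda>N. (of_nat (Suc N) + w - 1/2) * Ln (1 + w / of_nat (Suc N)) - w
      + w * of_real (ln (real (Suc N)) - ln (real N)))"
  have w: "w \<notin> \<int>\<^sub>\<le>\<^sub>0" using assms(1) by (rule Re_pos_not_nonpos_Ints)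
  have G0: "Gamma w \<noteq> 0" using w by (simp add: Gamma_eq_zero_iff)
  have "(\<lambda>N. Gamma_series w N / Gamma w) \<longlonglongrightarrow> Gamma w / Gamma w"
    using G0 by (intro tendsto_intros)
  then have lim1: "(\<lambda>N. Gamma_series w N / Gamma w) \<longlonglongrightarrow> 1" using G0 by simp
  have "D \<longlonglongrightarrow> 0"
  proof -
    have a: "(\<lambda>N. w / of_nat (Suc N)) \<longlonglongrightarrow> 0"
      using lim_const_over_n[of w] by (rule LIMSEQ_Suc)
    have "(\<lambda>N. Ln (1 + w / of_nat (Suc N))) \<longlonglongrightarrow> Ln (1 + 0)"
      by (intro tendsto_intros a) auto
    then have b: "(\<lambda>N. (w - 1/2) * Ln (1 + w / of_nat (Suc N))) \<longlonglongrightarrow> (w - 1/2) * 0"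
      by (intro tendsto_intros) simp
    have "(\<lambda>N. ln (real (Suc N)) - ln (real N)) \<longlonglongrightarrow> 0" by real_asymp
    then have c: "(\<lambda>N. w * of_real (ln (real (Suc N)) - ln (real N))) \<longlonglongrightarrow> w * of_real 0"
      by (intro tendsto_intros)
    have "(\<lambda>N. of_nat (Suc N) * Ln (1 + w / of_nat (Suc N))
        + (w - 1/2) * Ln (1 + w / of_nat (Suc N)) - w
        + w * of_real (ln (real (Suc N)) - ln (real N))) \<longlonglongrightarrow> w + (w - 1/2) * 0 - w + w * of_real 0"
      by (intro tendsto_add tendsto_diff nat_times_Ln_tendsto b c tendsto_const)
    then show ?thesis by (simp add: D_def algebra_simps)
  qed
  then have expD: "(\<lambda>N. exp (D N)) \<longlonglongrightarrow> exp 0" by (rule tendsto_exp)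
  then have lim: "(\<lambda>N. stirling_ratio (of_nat (Suc N)) / ((Gamma_series w N / Gamma w) * exp (D N)))
      \<longlonglongrightarrow> K / (1 * exp 0)"
    by (intro tendsto_divide tendsto_mult K lim1 expD) auto
  have "\<forall>\<^sub>F N in sequentially.
      stirling_ratio (of_nat (Suc N)) / ((Gamma_series w N / Gamma w) * exp (D N))
      = stirling_ratio (w + of_nat (Suc N))"
    using eventually_gt_at_top[of 0]
  proof eventually_elim
    case (elim N)
    define M :: complex where "M = of_nat (Suc N)"
    have M0: "M \<noteq> 0" "0 < Re M" by (simp_all add: M_def del: of_nat_Suc)
    have "Re (1 + w / M) > 0"
    proof -
      have "w / M = w / of_real (real (Suc N))" by (simp add: M_def)
      then have "Re (w / M) = Re w / real (Suc N)" by (simp only: Re_divide_of_real)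
      then show ?thesis using assms(1) by (simp add: add_pos_pos)
    qed
    then have "Ln (M * (1 + w / M)) = Ln M + Ln (1 + w / M)"
      by (intro Ln_mult_Re_pos M0)
    moreover have "M * (1 + w / M) = w + M" using M0 by (simp add: field_simps)
    moreover have LnM: "Ln M = of_real (ln (real (Suc N)))"
      unfolding M_def by (rule Ln_of_nat) simp
    ultimately have "(w + M - 1/2) * Ln (w + M) - (w + M)
       = ((M - 1/2) * Ln M - M) + w * of_real (ln (real N))
         + ((M + w - 1/2) * Ln (1 + w / M) - w + w * (Ln M - of_real (ln (real N))))"
      by (simp add: algebra_simps)
    also have "(M + w - 1/2) * Ln (1 + w / M) - w + w * (Ln M - of_real (ln (real N))) = D N"
      unfolding D_def M_def[symmetric] LnM by simp
    finally have "(w + M - 1/2) * Ln (w + M) - (w + M)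
       = ((M - 1/2) * Ln M - M) + w * of_real (ln (real N)) + D N" .
    then have e: "exp ((w + M - 1/2) * Ln (w + M) - (w + M))
       = exp ((M - 1/2) * Ln M - M) * exp (w * of_real (ln (real N))) * exp (D N)"
      by (simp only: exp_add)
    have g: "Gamma_series w N / Gamma w = Gamma M * exp (w * of_real (ln (real N))) / Gamma (w + M)"
    proof -
      have "pochhammer w (N + 1) = Gamma (w + M) / Gamma w"
        using pochhammer_Gamma[OF w, of "N + 1"] by (simp add: M_def)
      moreover have "Gamma M = fact N" using Gamma_fact[of N, where 'a = complex] by (simp add: M_def add.commute)
      ultimately show ?thesis using G0 by (simp add: Gamma_series_def)
    qed
    have "Gamma M \<noteq> 0" "Gamma (w + M) \<noteq> 0"
      using M0 assms(1) by (simp_all add: Gamma_eq_zero_iff Re_pos_not_nonpos_Ints)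
    then show ?case
      unfolding M_def[symmetric] stirling_ratio_def e g by (simp add: field_simps)
  qed
  then show ?thesis using Lim_transform_eventually[OF lim] by simp
qed

lemma stirling_ratio_of_real:
  assumes "0 < x"
  shows "stirling_ratio (of_real x) = Gamma (of_real x) / of_real (exp ((x - 1/2) * ln x - x))"
proof -
  have "(of_real x - 1/2) * Ln (of_real x) - of_real x = of_real ((x - 1/2) * ln x - x)"
    using assms by (simp add: Ln_of_real)
  then show ?thesis by (simp only: stirling_ratio_def exp_of_real)
qed

lemma stirling_ratio_duplication:
  assumes "0 < x"
  shows "stirling_ratio (of_real x) * stirling_ratio (of_real (x + 1/2)) =
     of_real (sqrt pi * exp ((1 - 2 * x) * ln 2 + ((2 * x - 1/2) * ln (2 * x) - 2 * x)
        - ((x - 1/2) * ln x - x) - (x * ln (x + 1/2) - (x + 1/2))))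
     * stirling_ratio (of_real (2 * x))"
proof -
  have "of_real x \<notin> (\<int>\<^sub>\<le>\<^sub>0 :: complex set)" "of_real x + 1/2 \<notin> (\<int>\<^sub>\<le>\<^sub>0 :: complex set)"
    using assms by (auto intro!: Re_pos_not_nonpos_Ints)
  from Gamma_legendre_duplication[OF this]
  have "Gamma (of_real x) * Gamma (of_real (x + 1/2)) =
      of_real (exp ((1 - 2 * x) * ln 2) * sqrt pi) * Gamma (of_real (2 * x) :: complex)"
    by (simp flip: exp_of_real)
  moreover have "(A / of_real q) * (B / of_real r) = of_real (c * (p * s / q / r)) * (C / of_real s)"
    if "A * B = of_real (p * c) * C" "q \<noteq> 0" "r \<noteq> 0" "s \<noteq> 0"
    for A B C :: complex and p c q r s :: real
    using that by (simp add: field_simps)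
  moreover have "stirling_ratio (of_real (x + 1/2)) =
      Gamma (of_real (x + 1/2)) / of_real (exp (x * ln (x + 1/2) - (x + 1/2)))"
    using stirling_ratio_of_real[of "x + 1/2"] assms by simp
  ultimately show ?thesis
    using stirling_ratio_of_real[of x] stirling_ratio_of_real[of "2 * x"] assms
    by (simp only: exp_add exp_diff) simp
qed

text \<open>Letting \<open>x\<close> run through the positive integers in the duplication formula yields the equation
\<open>K\<^sup>2 = sqrt (2 \<pi>) K\<close> for the limit, where \<open>K \<noteq> 0\<close>.\<close>

lemma stirling_ratio_nat_tendsto:
  "(\<lambda>N. stirling_ratio (of_nat (Suc N))) \<longlonglongrightarrow> of_real (sqrt (2 * pi))"
proof -
  obtain K where K: "(\<lambda>N. stirling_ratio (of_nat (Suc N))) \<longlonglongrightarrow> K" and K0: "K \<noteq> 0"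
    by (rule stirling_ratio_nat_convergent)
  have "(\<lambda>N. stirling_ratio (1/2 + of_nat (Suc N))) \<longlonglongrightarrow> K"
    by (intro stirling_ratio_translate K) simp
  then have lhs: "(\<lambda>N. stirling_ratio (of_nat (Suc N)) * stirling_ratio (1/2 + of_nat (Suc N))) \<longlonglongrightarrow> K * K"
    by (intro tendsto_mult K)
  have "filterlim (\<lambda>N. 2 * N + 1 :: nat) at_top sequentially" by real_asymp
  from filterlim_compose[OF K this]
  have even: "(\<lambda>N. stirling_ratio (of_nat (2 * Suc N))) \<longlonglongrightarrow> K" by (simp add: add_ac)
  have "(\<lambda>N. sqrt pi * exp ((1 - 2 * real (Suc N)) * ln 2
      + ((2 * real (Suc N) - 1/2) * ln (2 * real (Suc N)) - 2 * real (Suc N))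
      - ((real (Suc N) - 1/2) * ln (real (Suc N)) - real (Suc N))
      - (real (Suc N) * ln (real (Suc N) + 1/2) - (real (Suc N) + 1/2)))) \<longlonglongrightarrow> sqrt pi * exp (ln 2 / 2)"
    by (rule tendsto_mult_left) real_asymp
  moreover have "sqrt pi * exp (ln 2 / 2) = sqrt (2 * pi)"
  proof -
    have "exp (ln 2 / 2) = sqrt (2::real)"
      by (simp add: ln_sqrt[symmetric])
    then show ?thesis by (simp add: real_sqrt_mult)
  qed
  ultimately have "(\<lambda>N. of_real (sqrt pi * exp ((1 - 2 * real (Suc N)) * ln 2
      + ((2 * real (Suc N) - 1/2) * ln (2 * real (Suc N)) - 2 * real (Suc N))
      - ((real (Suc N) - 1/2) * ln (real (Suc N)) - real (Suc N))
      - (real (Suc N) * ln (real (Suc N) + 1/2) - (real (Suc N) + 1/2))))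
      * stirling_ratio (of_nat (2 * Suc N))) \<longlonglongrightarrow> of_real (sqrt (2 * pi)) * K"
    by (intro tendsto_mult tendsto_of_real even) simp
  moreover have "stirling_ratio (of_nat (Suc N)) * stirling_ratio (1/2 + of_nat (Suc N)) =
     of_real (sqrt pi * exp ((1 - 2 * real (Suc N)) * ln 2
      + ((2 * real (Suc N) - 1/2) * ln (2 * real (Suc N)) - 2 * real (Suc N))
      - ((real (Suc N) - 1/2) * ln (real (Suc N)) - real (Suc N))
      - (real (Suc N) * ln (real (Suc N) + 1/2) - (real (Suc N) + 1/2))))
      * stirling_ratio (of_nat (2 * Suc N))" for N
  proof -
    have "of_real (real (Suc N)) = (of_nat (Suc N) :: complex)"
      "of_real (real (Suc N) + 1/2) = (1/2 + of_nat (Suc N) :: complex)"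
      "of_real (2 * real (Suc N)) = (of_nat (2 * Suc N) :: complex)" by simp_all
    then show ?thesis using stirling_ratio_duplication[of "real (Suc N)"] by (simp only: of_nat_0_less_iff zero_less_Suc)
  qed
  ultimately have "K * K = of_real (sqrt (2 * pi)) * K"
    using LIMSEQ_unique[OF lhs] by simp
  then show ?thesis using K K0 by simp
qed

text \<open>Termwise comparison of the two power series without their constant terms.\<close>

lemma norm_exp_minus_1_le: "norm (exp z - 1) \<le> exp (norm z) - 1" for z :: complex
proof -
  have c: "(\<lambda>n. norm z ^ Suc n /\<^sub>R fact (Suc n)) sums (exp (norm z) - 1)"
    using exp_converges[of "norm z"] by (subst sums_Suc_iff) simp
  have "(\<lambda>n. z ^ Suc n /\<^sub>R fact (Suc n)) sums (exp z - 1)"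
    using exp_converges[of z] by (subst sums_Suc_iff) simp
  then have "norm (exp z - 1) = norm (\<Sum>n. z ^ Suc n /\<^sub>R fact (Suc n))"
    by (simp only: sums_iff)
  also have "\<dots> \<le> (\<Sum>n. norm z ^ Suc n /\<^sub>R fact (Suc n))"
    using sums_summable[OF c] by (intro norm_suminf_le) (simp_all add: norm_mult norm_power)
  also have "\<dots> = exp (norm z) - 1" using c by (simp only: sums_iff)
  finally show ?thesis .
qed

abbreviation (input) stirling_quotient :: "complex \<Rightarrow> complex" where
  "stirling_quotient w \<equiv> stirling_ratio w / of_real (sqrt (2 * pi))"

text \<open>Move \<open>w\<close> to infinity along \<open>w + N\<close>, where the quotient tends to \<open>1\<close>; the accumulated defects are at
most \<open>1 / Re w\<close> by telescoping.\<close>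

theorem complex_stirling:
  assumes "1 \<le> Re w"
  shows "norm (stirling_quotient w - 1) \<le> exp (1 / Re w) - 1"
proof -
  define S where "S = (\<lambda>N. \<Sum>k<N. stirling_defect (w + of_nat k))"
  have Re: "0 < Re w" using assms by simp
  have "(\<lambda>N. stirling_ratio (w + of_nat (Suc N))) \<longlonglongrightarrow> of_real (sqrt (2 * pi))"
    by (intro stirling_ratio_translate stirling_ratio_nat_tendsto Re)
  then have "(\<lambda>N. stirling_ratio w / stirling_ratio (w + of_nat (Suc N)) - 1)
      \<longlonglongrightarrow> stirling_ratio w / of_real (sqrt (2 * pi)) - 1"
    by (intro tendsto_intros) auto
  then have "(\<lambda>N. norm (stirling_ratio w / stirling_ratio (w + of_nat (Suc N)) - 1))
      \<longlonglongrightarrow> norm (stirling_ratio w / of_real (sqrt (2 * pi)) - 1)"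
    by (rule tendsto_norm)
  moreover have "norm (stirling_ratio w / stirling_ratio (w + of_nat (Suc N)) - 1)
      \<le> exp (1 / Re w) - 1" for N
  proof -
    have "stirling_ratio (w + of_nat (Suc N)) \<noteq> 0"
      using Re by (simp add: stirling_ratio_def Gamma_eq_zero_iff Re_pos_not_nonpos_Ints)
    then have "stirling_ratio w / stirling_ratio (w + of_nat (Suc N)) = exp (S (Suc N))"
      using stirling_ratio_shift[OF Re, of "Suc N"] by (simp add: S_def)
    moreover have "norm (exp (S (Suc N)) - 1) \<le> exp (norm (S (Suc N))) - 1"
      by (rule norm_exp_minus_1_le)
    moreover have "norm (S (Suc N)) \<le> 1 / Re w"
      unfolding S_def by (rule norm_sum_stirling_defect_le[OF assms])
    ultimately show ?thesis
      by (smt (verit) exp_le_cancel_iff)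
  qed
  ultimately show ?thesis by (intro LIMSEQ_le_const2) auto
qed

section \<open>A product perturbed by a three-term recurrence\<close>

text \<open>For \<open>v\<close> without the term \<open>1/4\<close> one would have \<open>v n = (\<Prod>k<n. a k)\<close>.  All factors except possibly
\<open>a m\<close> have modulus at least \<open>B\<close>.  Dividing \<open>v k\<close> by the product of the first \<open>k\<close> factors with \<open>a m\<close>
omitted gives a sequence \<open>q\<close> whose ideal values are \<open>1\<close> up to index \<open>m\<close> and \<open>a m\<close> afterwards.  A
step of the recurrence away from \<open>m\<close> disturbs \<open>q\<close> by \<open>O(1 / B\<^sup>2)\<close>, in units of \<open>norm (a m) + 1\<close>; only
the two steps in which the divisor of the perturbing term lacks a factor because of the omission of
\<open>a m\<close> disturb it by \<open>O(1 / B)\<close>.\<close>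

lemma perturbed_product_bound:
  fixes a v :: "nat \<Rightarrow> complex"
  assumes v0: "v 0 = 1" and v1: "v 1 = a 0"
    and v_rec: "\<And>k. v (Suc (Suc k)) = a (Suc k) * v (Suc k) - 1/4 * v k"
    and m: "0 < m" "m < n" and B: "0 < B"
    and big: "\<And>k. k < n \<Longrightarrow> k \<noteq> m \<Longrightarrow> B \<le> norm (a k)"
    and small: "real n / (2 * B\<^sup>2) + 1 / B \<le> 1"
  shows "norm (v n - (\<Prod>k<n. a k))
    \<le> (\<Prod>k\<in>{..<n} - {m}. norm (a k)) * ((norm (a m) + 1) * (real n / (2 * B\<^sup>2) + 1 / B))"
proof -
  define b where "b = (\<lambda>k. if k = m then 1 else a k)"
  define p where "p = (\<lambda>k. \<Prod>j<k. b j)"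
  define q where "q = (\<lambda>k. v k / p k)"
  define h where "h = 1 / (4 * B\<^sup>2)"
  define A where "A = norm (a m)"
  have h0: "0 < h" using B by (simp add: h_def)
  have A0: "0 \<le> A" by (simp add: A_def)
  have small': "2 * real n * h + 1 / B \<le> 1"
    using small by (simp add: h_def)
  have B1: "1 / B \<le> 1"
    using small' h0 by (smt (verit) mult_nonneg_nonneg of_nat_0_le_iff)
  have nh: "2 * real n * h \<le> 1" using small' B by (smt (verit) divide_pos_pos)
  have kh: "2 * real k * h \<le> 2 * real n * h" if "k \<le> n" for k
    using that h0 by simp
  have b0: "b k \<noteq> 0" if "k < n" for k
    using big[OF that] B by (auto simp: b_def)
  have p0: "p k \<noteq> 0" if "k \<le> n" for k
    using b0 that by (auto simp: p_def)
  have q_rec: "q (Suc (Suc k)) = a (Suc k) / b (Suc k) * q (Suc k) - 1/4 * q k / (b k * b (Suc k))"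
    if "Suc k < n" for k
  proof -
    have "p (Suc k) = p k * b k" "p (Suc (Suc k)) = p k * b k * b (Suc k)"
      by (simp_all add: p_def)
    then show ?thesis
      using that p0[of k] b0[of k] b0[of "Suc k"] by (simp add: q_def v_rec field_simps)
  qed
  have step: "norm (1/4 * x / (y * z)) \<le> C * h"
    if "norm x \<le> C" "B \<le> norm y" "B \<le> norm z" for x y z :: complex and C
  proof -
    have "B * B \<le> norm y * norm z" using that B by (intro mult_mono) auto
    then have "norm x / (4 * (norm y * norm z)) \<le> C / (4 * (B * B))"
      using that B by (intro frac_le) (auto intro: order_trans[OF norm_ge_zero])
    then show ?thesis by (simp add: norm_divide norm_mult h_def power2_eq_square)
  qed
  have step1: "norm (1/4 * x / y) \<le> 1 / (2 * B)"
    if "norm x \<le> 2" "B \<le> norm y" for x y :: complex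
  proof -
    have "norm x / (4 * norm y) \<le> 2 / (4 * B)" using that B by (intro frac_le) auto
    then show ?thesis by (simp add: norm_divide norm_mult)
  qed
  \<comment> \<open>After \<open>m\<close> the two exceptional steps contribute \<open>1 / (2 B)\<close> each: the first one produces
    index \<open>m + 1\<close>, the second one index \<open>m + 2\<close>.\<close>
  have claim: "(k \<le> m \<longrightarrow> norm (q k - 1) \<le> 2 * real k * h) \<and>
      (m < k \<longrightarrow> norm (q k - a m) \<le> (A + 1) * (2 * real k * h) + (if k = Suc m then 1 / (2 * B) else 1 / B))"
    if "k \<le> n" for k using that
  proof (induction k rule: less_induct)
    case (less k)
    have q_le_2: "norm (q j) \<le> 2" if "j \<le> m" "j < k" for j
    proof -
      have "norm (q j - 1) \<le> 2 * real j * h" using less.IH[of j] less.prems that by auto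
      then have "norm (q j - 1) \<le> 1" using kh[of j] nh that less.prems by linarith
      then show ?thesis using norm_triangle_ineq[of "q j - 1" 1] by simp
    qed
    have q_le: "norm (q j) \<le> 2 * (A + 1)" if "m < j" "j < k" for j
    proof -
      have "norm (q j - a m) \<le> (A + 1) * (2 * real j * h) + (if j = Suc m then 1 / (2 * B) else 1 / B)"
        using less.IH[of j] less.prems that by auto
      also have "\<dots> \<le> (A + 1) * (2 * real n * h) + (A + 1) * (1 / B)"
      proof (intro add_mono mult_left_mono kh)
        have "(if j = Suc m then 1 / (2 * B) else 1 / B) \<le> 1 * (1 / B)"
          using B by (simp add: field_simps)
        also have "\<dots> \<le> (A + 1) * (1 / B)" using A0 B by (intro mult_right_mono) auto
        finally show "(if j = Suc m then 1 / (2 * B) else 1 / B) \<le> (A + 1) * (1 / B)" .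
      qed (use that less.prems A0 in auto)
      also have "\<dots> = (A + 1) * (2 * real n * h + 1 / B)" by (simp add: algebra_simps)
      also have "\<dots> \<le> (A + 1) * 1" using small' A0 by (intro mult_left_mono) auto
      finally show ?thesis
        using norm_triangle_ineq[of "q j - a m" "a m"] by (simp add: A_def)
    qed
    consider "k = 0" | "k = 1" | j where "k = Suc (Suc j)"
      by (cases k; cases "k - 1") auto
    then show ?case
    proof cases
      case 1
      then show ?thesis by (simp add: q_def p_def v0)
    next
      case 2
      have "a 0 \<noteq> 0" using b0[of 0] m by (simp add: b_def)
      then show ?thesis using 2 m h0 v1 by (simp add: q_def p_def b_def)
    next
      case j: 3
      have jn: "Suc j < n" "j < n" using less.prems j by auto
      note rec = q_rec[OF jn(1), folded j]
      have IH0: "Suc j \<le> m \<Longrightarrow> norm (q (Suc j) - 1) \<le> 2 * real (Suc j) * h"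
        and IH1: "m < Suc j \<Longrightarrow> norm (q (Suc j) - a m) \<le> (A + 1) * (2 * real (Suc j) * h)
           + (if Suc j = Suc m then 1 / (2 * B) else 1 / B)"
        using less.IH[of "Suc j"] less.prems j by auto
      have rk: "2 * real k * h = 2 * real (Suc j) * h + 2 * h" by (simp add: j algebra_simps)
      consider "k \<le> m" | "Suc j = m" | "j = m" | "m < j" using j by linarith
      then show ?thesis
      proof cases
        case 1
        then have "b j = a j" "b (Suc j) = a (Suc j)" using j by (auto simp: b_def)
        then have eq: "q k - 1 = (q (Suc j) - 1) - 1/4 * q j / (a j * a (Suc j))"
          using rec b0[OF jn(1)] by simp
        have "norm (1/4 * q j / (a j * a (Suc j))) \<le> 2 * h"
          using 1 j jn by (intro step q_le_2 big) auto
        then have "norm (q (Suc j) - 1) + norm (1/4 * q j / (a j * a (Suc j))) \<le> 2 * real k * h"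
          using IH0 1 j rk by simp
        then show ?thesis unfolding eq using 1 norm_triangle_le_diff by auto
      next
        case 2
        then have "b j = a j" "b (Suc j) = 1" by (auto simp: b_def)
        then have eq: "q k - a m = a m * (q (Suc j) - 1) - 1/4 * q j / a j"
          using rec 2 by (simp add: algebra_simps)
        have "norm (1/4 * q j / a j) \<le> 1 / (2 * B)"
          using 2 j jn by (intro step1 q_le_2 big) auto
        moreover have "norm (a m * (q (Suc j) - 1)) \<le> (A + 1) * (2 * real k * h)"
          unfolding norm_mult A_def using IH0 2 h0 rk by (intro mult_mono) auto
        ultimately have "norm (a m * (q (Suc j) - 1)) + norm (1/4 * q j / a j)
            \<le> (A + 1) * (2 * real k * h) + 1 / (2 * B)" by (rule add_mono[rotated])
        then show ?thesis unfolding eq using 2 j norm_triangle_le_diff by auto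
      next
        case 3
        then have "b j = 1" "b (Suc j) = a (Suc j)" by (auto simp: b_def)
        then have eq: "q k - a m = (q (Suc j) - a m) - 1/4 * q j / a (Suc j)"
          using rec b0[OF jn(1)] by simp
        have "norm (1/4 * q j / a (Suc j)) \<le> 1 / (2 * B)"
          using 3 j jn by (intro step1 q_le_2 big) auto
        moreover have "norm (q (Suc j) - a m) \<le> (A + 1) * (2 * real (Suc j) * h) + 1 / (2 * B)"
          using IH1 3 by simp
        moreover have "(A + 1) * (2 * real (Suc j) * h) \<le> (A + 1) * (2 * real k * h)"
          using A0 h0 rk by (intro mult_left_mono) auto
        moreover have "1 / (2 * B) + 1 / (2 * B) = 1 / B" by (simp add: field_simps)
        ultimately have "norm (q (Suc j) - a m) + norm (1/4 * q j / a (Suc j))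
            \<le> (A + 1) * (2 * real k * h) + 1 / B" by linarith
        then show ?thesis unfolding eq using 3 j norm_triangle_le_diff by auto
      next
        case 4
        then have "b j = a j" "b (Suc j) = a (Suc j)" by (auto simp: b_def)
        then have eq: "q k - a m = (q (Suc j) - a m) - 1/4 * q j / (a j * a (Suc j))"
          using rec b0[OF jn(1)] by simp
        have "norm (1/4 * q j / (a j * a (Suc j))) \<le> 2 * (A + 1) * h"
          using 4 j jn by (intro step q_le big) auto
        moreover have "norm (q (Suc j) - a m) \<le> (A + 1) * (2 * real (Suc j) * h) + 1 / B"
          using IH1 4 by simp
        moreover have "(A + 1) * (2 * real k * h) = (A + 1) * (2 * real (Suc j) * h) + 2 * (A + 1) * h"
          unfolding rk by (simp add: algebra_simps)
        ultimately have "norm (q (Suc j) - a m) + norm (1/4 * q j / (a j * a (Suc j)))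
            \<le> (A + 1) * (2 * real k * h) + 1 / B" by linarith
        then show ?thesis unfolding eq using 4 j norm_triangle_le_diff by auto
      qed
    qed
  qed
  have "norm (q n - a m) \<le> (A + 1) * (2 * real n * h) + (if n = Suc m then 1 / (2 * B) else 1 / B)"
    using claim[of n] m by simp
  also have "\<dots> \<le> (A + 1) * (2 * real n * h) + (A + 1) * (1 / B)"
  proof -
    have "(if n = Suc m then 1 / (2 * B) else 1 / B) \<le> 1 * (1 / B)"
      using B by (simp add: field_simps)
    also have "\<dots> \<le> (A + 1) * (1 / B)" using A0 B by (intro mult_right_mono) auto
    finally show ?thesis by simp
  qed
  also have "\<dots> = (A + 1) * (real n / (2 * B\<^sup>2) + 1 / B)"
    by (simp add: h_def algebra_simps)
  finally have qn: "norm (q n - a m) \<le> (A + 1) * (real n / (2 * B\<^sup>2) + 1 / B)" .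
  have pn: "p n = (\<Prod>k\<in>{..<n} - {m}. a k)"
    unfolding p_def b_def using m by (subst prod.remove[of _ m]) (auto intro!: prod.cong)
  have "(\<Prod>k<n. a k) = p n * a m"
    unfolding pn using m by (subst prod.remove[of _ m]) auto
  moreover have "v n = p n * q n" using p0[of n] by (simp add: q_def)
  ultimately have "v n - (\<Prod>k<n. a k) = p n * (q n - a m)" by (simp add: algebra_simps)
  then show ?thesis
    using qn by (simp add: norm_mult pn prod_norm A_def mult_left_mono)
qed

section \<open>The unperturbed product\<close>

lemma prod_square_diff_eq_Gamma_sin:
  fixes z :: complex
  assumes "\<bar>Re z\<bar> < real n"
  shows "(\<Prod>k<n. z\<^sup>2 - (of_nat k)\<^sup>2) =
    (-1) ^ (n - 1) * z * Gamma (of_nat n + z) * Gamma (of_nat n - z) * sin (of_real pi * z) / of_real pi"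
proof -
  have n: "0 < n" using assms by (cases n) auto
  have split: "(\<Prod>k<n. z\<^sup>2 - (of_nat k)\<^sup>2) = (-1) ^ n * (pochhammer z n * pochhammer (-z) n)"
  proof -
    have "(\<Prod>k<n. z\<^sup>2 - (of_nat k)\<^sup>2) = (\<Prod>k<n. (-1) * ((z + of_nat k) * (-z + of_nat k)))"
      by (intro prod.cong) (auto simp: power2_eq_square algebra_simps)
    also have "\<dots> = (-1) ^ n * (pochhammer z n * pochhammer (-z) n)"
      by (simp only: prod.distrib pochhammer_prod prod_constant card_lessThan atLeast0LessThan)
    finally show ?thesis .
  qed
  have cancel: "pochhammer w n = rGamma w * Gamma (of_nat n + w)" if "0 < Re (of_nat n + w)" for w :: complex
  proof -
    have "Gamma (of_nat n + w) \<noteq> 0"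
      unfolding Gamma_eq_zero_iff using Re_pos_not_nonpos_Ints[OF that] .
    then show ?thesis
      using pochhammer_rGamma[of w n] by (simp add: rGamma_inverse_Gamma add.commute)
  qed
  have "pochhammer z n * pochhammer (-z) n =
      (rGamma z * rGamma (-z)) * (Gamma (of_nat n + z) * Gamma (of_nat n - z))"
    using cancel[of z] cancel[of "-z"] assms by simp
  also have "rGamma z * rGamma (-z) = -z * sin (of_real pi * z) / of_real pi"
    by (rule rGamma_reflection_complex')
  finally have poch: "pochhammer z n * pochhammer (-z) n =
      -z * sin (of_real pi * z) / of_real pi * (Gamma (of_nat n + z) * Gamma (of_nat n - z))" .
  have "(-1::complex) ^ n = - ((-1) ^ (n - 1))" using n by (cases n) auto
  then show ?thesis unfolding split poch by simp
qed

lemma norm_sin_le_norm_times_exp: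
  fixes w :: complex
  shows "norm (sin w) \<le> norm w * exp \<bar>Im w\<bar>"
proof -
  have "norm (sin w - sin 0) \<le> exp \<bar>Im w\<bar> * norm (w - 0)"
  proof (rule field_differentiable_bound[where S = "closed_segment 0 w" and f' = cos])
    fix t assume "t \<in> closed_segment 0 w"
    then obtain u where "t = u *\<^sub>R w" "0 \<le> u" "u \<le> 1" by (auto simp: in_segment)
    then show "norm (cos t) \<le> exp \<bar>Im w\<bar>" using cmod_cos_le_exp by blast
  qed (auto intro: DERIV_subset DERIV_sin)
  then show ?thesis by (simp add: mult.commute)
qed

text \<open>The sine and the cosine cannot be small simultaneously, even relative to their exponential growth:
\<open>exp (\<i> w)\<close> and \<open>exp (- \<i> w)\<close> are both combinations of them with unimodular coefficients.\<close>

lemma exp_abs_Im_le_sin_cos: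
  fixes w :: complex
  shows "exp \<bar>Im w\<bar> \<le> norm (sin w) + norm (cos w)"
proof -
  have "exp (- Im w) = norm (cos w + \<i> * sin w)" "exp (Im w) = norm (cos w - \<i> * sin w)"
    using exp_Euler[of w] exp_Euler[of "-w"] norm_exp_eq_Re[of "\<i> * w"] norm_exp_eq_Re[of "-(\<i> * w)"] by auto
  then show ?thesis
    using norm_triangle_ineq[of "cos w" "\<i> * sin w"] norm_triangle_ineq4[of "cos w" "\<i> * sin w"]
    by (auto simp: norm_mult abs_if)
qed

lemma norm_sin_pi_le_dist_int:
  fixes z :: complex
  shows "norm (sin (of_real pi * z)) \<le> pi * norm (z - of_nat m) * exp (pi * \<bar>Im z\<bar>)"
proof -
  have "of_real pi * of_nat m = (of_real (pi * real m) :: complex)" by simp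
  then have "sin (of_real pi * of_nat m :: complex) = 0" "cos (of_real pi * of_nat m :: complex) = (-1) ^ m"
    by (simp_all only: sin_of_real cos_of_real sin_npi2 cos_npi2) simp_all
  then have "sin (of_real pi * (z - of_nat m)) = (-1) ^ m * sin (of_real pi * z)"
    by (simp add: right_diff_distrib sin_diff)
  then have "norm (sin (of_real pi * z)) = norm (sin (of_real pi * (z - of_nat m)))"
    by (simp add: norm_mult norm_power)
  also have "\<dots> \<le> norm (of_real pi * (z - of_nat m)) * exp \<bar>Im (of_real pi * (z - of_nat m))\<bar>"
    by (rule norm_sin_le_norm_times_exp)
  finally show ?thesis by (simp add: norm_mult abs_mult)
qed

text \<open>Away from \<open>m\<close>, divide the Gamma-sine formula by \<open>z - m\<close> and use that the sine vanishes at \<open>m\<close>.  At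
\<open>z = m\<close> both sides are continuous, so the inequality persists.\<close>

lemma prod_square_diff_omit_le:
  fixes z :: complex
  assumes m: "0 < m" "m < n" and z: "\<bar>Re z\<bar> < real n"
  shows "(\<Prod>k\<in>{..<n} - {m}. norm (z\<^sup>2 - (of_nat k)\<^sup>2)) * norm (z + of_nat m)
    \<le> norm (z * Gamma (of_nat n + z) * Gamma (of_nat n - z)) * exp (pi * \<bar>Im z\<bar>)"
    (is "?L z \<le> ?R z")
proof -
  have off: "?L z \<le> ?R z" if z: "\<bar>Re z\<bar> < real n" "z \<noteq> of_nat m" for z :: complex
  proof -
    have "?L z * norm (z - of_nat m) = norm (\<Prod>k<n. z\<^sup>2 - (of_nat k)\<^sup>2)"
    proof -
      have "z\<^sup>2 - (of_nat m)\<^sup>2 = (z + of_nat m) * (z - of_nat m)"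
        by (simp add: power2_eq_square algebra_simps)
      then show ?thesis
        using m by (subst prod.remove[of _ m]) (auto simp: norm_mult prod_norm)
    qed
    also have "\<dots> = norm (z * Gamma (of_nat n + z) * Gamma (of_nat n - z)) *
        norm (sin (of_real pi * z)) / pi"
      unfolding prod_square_diff_eq_Gamma_sin[OF z(1)] by (simp add: norm_mult norm_divide norm_power)
    also have "\<dots> \<le> norm (z * Gamma (of_nat n + z) * Gamma (of_nat n - z)) *
        (pi * norm (z - of_nat m) * exp (pi * \<bar>Im z\<bar>)) / pi"
      by (intro divide_right_mono mult_left_mono norm_sin_pi_le_dist_int) auto
    also have "\<dots> = ?R z * norm (z - of_nat m)" by simp
    finally show ?thesis using z(2) by (simp add: mult_le_cancel_right)
  qed
  show ?thesis
  proof (cases "z = of_nat m")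
    case False
    then show ?thesis using off z by blast
  next
    case True
    have cL: "isCont ?L (of_nat m)" by (intro continuous_intros)
    have cR: "isCont ?R (of_nat m)"
      using m by (intro continuous_intros Re_pos_not_nonpos_Ints) auto
    have "open {z :: complex. \<bar>Re z\<bar> < real n}" by (intro open_Collect_less continuous_intros)
    then have "\<forall>\<^sub>F z :: complex in at (of_nat m). z \<in> {z. \<bar>Re z\<bar> < real n}"
      using m by (intro eventually_at_in_open') auto
    then have "\<forall>\<^sub>F z in at (of_nat m). ?L z \<le> ?R z"
      using eventually_neq_at_within[of "of_nat m" "of_nat m"]
      by eventually_elim (auto intro: off)
    then have "?L (of_nat m) \<le> ?R (of_nat m)"
      using tendsto_le[OF _ isContD[OF cR] isContD[OF cL]] by simp
    then show ?thesis using True by simp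
  qed
qed

section \<open>The asymptotic formula\<close>

lemma poly_pi_poly_rec:
  "poly (pi_poly (Suc (Suc k))) x =
    (x - (of_nat (Suc k))\<^sup>2) * poly (pi_poly (Suc k)) x - 1/4 * poly (pi_poly k) x"
  by (simp add: algebra_simps)

lemma norm_mult_minus_1_le:
  fixes a b :: complex
  assumes "norm (a - 1) \<le> d" "norm (b - 1) \<le> d"
  shows "norm (a * b - 1) \<le> (1 + d)\<^sup>2 - 1"
proof -
  have d: "0 \<le> d" using assms(1) norm_ge_zero order_trans by blast
  have "a * b - 1 = (a - 1) * (b - 1) + ((a - 1) + (b - 1))" by (simp add: algebra_simps)
  also have "norm \<dots> \<le> d * d + (d + d)"
    by (intro norm_triangle_mono order_trans[OF norm_triangle_ineq])
       (use assms d in \<open>auto simp: norm_mult intro!: mult_mono add_mono\<close>)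
  finally show ?thesis by (simp add: power2_eq_square algebra_simps)
qed

text \<open>For \<open>0 < Re s < 1\<close> all of \<open>1 + s\<close>, \<open>1 - s\<close> lie in the right half plane, so principal logarithms are additive
on them and the exponents \<open>(w - 1/2) Ln w - w\<close> at \<open>w = n (1 \<plusminus> s)\<close> add up without
branch corrections.  The identity is exact; all approximation sits in the two Stirling quotients.\<close>

lemma pi_prefactor_conv_Gamma:
  fixes y :: complex
  defines "s \<equiv> csqrt y"
  assumes n: "0 < n" and s: "0 < Re s" "Re s < 1"
  defines "z \<equiv> of_nat n * s"
  shows "(-1) ^ (n - 1) * z * Gamma (of_nat n + z) * Gamma (of_nat n - z) / of_real pi =
    pi_prefactor n y * (stirling_quotient (of_nat n + z) * stirling_quotient (of_nat n - z))"
proof -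
  define l where "l = Ln (of_nat n)"
  define a where "a = Ln (1 + s)"
  define b where "b = Ln (1 - s)"
  define N where "N = (of_nat n :: complex)"
  have N0: "N \<noteq> 0" "0 < Re N" using n by (simp_all add: N_def)
  have pos: "0 < Re (1 + s)" "0 < Re (1 - s)" using s by auto
  then have ne: "1 + s \<noteq> 0" "1 - s \<noteq> 0" by force+
  have y: "y = s\<^sup>2" by (simp add: s_def)
  have y1: "1 - y = (1 + s) * (1 - s)" by (simp add: y power2_eq_square algebra_simps)
  have "s \<noteq> 0" using s by auto
  then have y0: "y \<noteq> 0" by (simp add: y)
  have w: "of_nat n + z = N * (1 + s)" "of_nat n - z = N * (1 - s)"
    by (simp_all add: z_def N_def algebra_simps)
  have Ln1: "Ln (N * (1 + s)) = l + a" "Ln (N * (1 - s)) = l + b"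
    using n ne by (simp_all add: N_def l_def a_def b_def Ln_times_of_nat)
  have expl: "exp l = N" unfolding l_def N_def[symmetric] by (rule exp_Ln[OF N0(1)])
  have Gamma_eq: "Gamma v = stirling_ratio v * exp ((v - 1/2) * Ln v - v)" for v
    by (simp add: stirling_ratio_def)
  \<comment> \<open>The powers of \<open>n\<close> recombine to \<open>(n / e)\<^sup>2\<^sup>n / n\<close>, and \<open>1 / n\<close> cancels the \<open>n\<close> in \<open>z = n s\<close>.\<close>
  have exponents: "((N * (1 + s) - 1/2) * (l + a) - N * (1 + s)) + ((N * (1 - s) - 1/2) * (l + b) - N * (1 - s))
     = of_nat (2 * n) * (l - 1) - l + N * s * (a - b) + (N - 1/2) * (a + b)"
    by (simp add: N_def) (simp add: field_simps)
  have "Gamma (of_nat n + z) * Gamma (of_nat n - z) =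
     stirling_ratio (of_nat n + z) * stirling_ratio (of_nat n - z) *
     exp (of_nat (2 * n) * (l - 1) - l + N * s * (a - b) + (N - 1/2) * (a + b))"
    unfolding w Gamma_eq[of "N * (1 + s)"] Gamma_eq[of "N * (1 - s)"] Ln1 exponents[symmetric] exp_add
    by (simp only: mult_ac)
  also have "exp (of_nat (2 * n) * (l - 1) - l + N * s * (a - b) + (N - 1/2) * (a + b)) =
     (N / exp 1) ^ (2 * n) / N * exp (N * s * (a - b)) * exp ((N - 1/2) * (a + b))"
    by (simp only: exp_add exp_diff exp_of_nat_mult expl)
  finally have G: "Gamma (of_nat n + z) * Gamma (of_nat n - z) =
     stirling_ratio (of_nat n + z) * stirling_ratio (of_nat n - z) *
     ((N / exp 1) ^ (2 * n) / N * exp (N * s * (a - b)) * exp ((N - 1/2) * (a + b)))" .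
  have p1: "((1 + s) / (1 - s)) powr (N * s) = exp (N * s * (a - b))"
    using ne by (simp add: powr_def Ln_divide_Re_pos[OF pos] a_def b_def)
  have p2: "(1 - y) powr (N - 1/2) = exp ((N - 1/2) * (a + b))"
    using ne unfolding y1 by (simp add: powr_def Ln_mult_Re_pos[OF pos] a_def b_def)
  have p3: "y powr (1/2) = s" by (simp add: s_def csqrt_conv_powr)
  have "pi_prefactor n y = (-1) ^ (n - 1) * 2 * (N / exp 1) ^ (2 * n) * exp (N * s * (a - b)) * s
      * exp ((N - 1/2) * (a + b))"
    unfolding pi_prefactor_def s_def[symmetric] N_def[symmetric] p1 p2 p3 ..
  moreover have "of_real (sqrt (2 * pi)) * of_real (sqrt (2 * pi)) = (2 * of_real pi :: complex)"
  proof -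
    have "of_real (sqrt (2 * pi)) * of_real (sqrt (2 * pi))
        = (of_real (sqrt (2 * pi) * sqrt (2 * pi)) :: complex)" by (simp only: of_real_mult)
    then show ?thesis by simp
  qed
  moreover have "(-1) ^ (n - 1) * z * Gamma (of_nat n + z) * Gamma (of_nat n - z) / of_real pi
     = (-1) ^ (n - 1) * z * (Gamma (of_nat n + z) * Gamma (of_nat n - z)) / of_real pi" by simp
  ultimately show ?thesis
    unfolding G using N0 by (simp add: z_def mult_ac flip: N_def)
qed

text \<open>Two errors are added.  With \<open>E = exp (2 / (c n))\<close>, the Stirling quotients contribute \<open>E - 1\<close>, and the perturbation of the product
contributes \<open>5 E \<kappa>\<close>, where \<open>\<kappa>\<close> is the constant of \<open>perturbed_product_bound\<close> for \<open>B = c n / 2\<close>.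
The \<open>5\<close> is \<open>1\<close> for the full product plus \<open>4 > \<pi>\<close> for the product without index \<open>m\<close>.\<close>

lemma pi_poly_approx:
  fixes y :: complex and c :: real
  defines "s \<equiv> csqrt y"
  assumes c: "0 < c" and s: "c < Re s" "Re s < 1 - c"
    and n: "1 \<le> c * real n" and small: "2 / (c\<^sup>2 * real n) + 2 / (c * real n) \<le> 1"
  defines "w \<equiv> of_nat n * of_real pi * s"
  shows "norm (poly (pi_poly n) ((of_nat n)\<^sup>2 * y) - pi_prefactor n y * sin w) \<le>
    norm (pi_prefactor n y) *
     ((exp (2 / (c * real n)) - 1
      + 5 * exp (2 / (c * real n)) * (2 / (c\<^sup>2 * real n) + 2 / (c * real n)))
      * (norm (sin w) + norm (cos w)))"
proof -
  define z where "z = of_nat n * s"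
  define M where "M = pi_prefactor n y"
  define r where "r = stirling_quotient (of_nat n + z) * stirling_quotient (of_nat n - z)"
  define E where "E = exp (2 / (c * real n))"
  define \<kappa> where "\<kappa> = 2 / (c\<^sup>2 * real n) + 2 / (c * real n)"
  define a where "a = (\<lambda>k. z\<^sup>2 - (of_nat k :: complex)\<^sup>2)"
  define m where "m = nat (round (Re z))"
  define W where "W = norm (sin w) + norm (cos w)"
  define Q where "Q = (\<Prod>k\<in>{..<n} - {m}. norm (a k))"
  have n0: "0 < n" using n by (cases n) auto
  have Rez: "c * real n < Re z" "Re z < real n - c * real n"
  proof -
    have "Re z = real n * Re s" by (simp add: z_def)
    moreover have "real n * c < real n * Re s" "real n * Re s < real n * (1 - c)"
      using s n0 by (auto intro!: mult_strict_left_mono)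
    ultimately show "c * real n < Re z" "Re z < real n - c * real n" by (simp_all add: algebra_simps)
  qed
  have wz: "w = of_real pi * z" by (simp add: w_def z_def)
  have z2: "(of_nat n)\<^sup>2 * y = z\<^sup>2" by (simp add: z_def s_def power_mult_distrib)
  have round: "\<bar>real_of_int (round (Re z)) - Re z\<bar> \<le> 1/2" by (rule of_int_round_abs_le)
  have "0 < round (Re z)" using round Rez n by linarith
  then have m_real: "real m = real_of_int (round (Re z))" "0 < m" by (simp_all add: m_def)
  have m: "0 < m" "m < n" "\<bar>real m - Re z\<bar> \<le> 1/2"
    using m_real round Rez n by linarith+
  have abs_Rez: "\<bar>Re z\<bar> < real n" using Rez n by linarith
  have W: "exp (pi * \<bar>Im z\<bar>) \<le> W" "norm (sin w) \<le> W" "0 \<le> W"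
    using exp_abs_Im_le_sin_cos[of w] by (simp_all add: W_def wz abs_mult)
  \<comment> \<open>Integers other than the nearest one are at distance at least \<open>1/2\<close> from \<open>z\<close>, and
    \<open>norm (z + k)\<close> is at least \<open>Re z > c n\<close>.\<close>
  have big: "c * real n / 2 \<le> norm (a k)" if "k \<noteq> m" for k
  proof -
    have "1 \<le> \<bar>real k - real m\<bar>" using that by linarith
    then have "1/2 \<le> \<bar>Re z - real k\<bar>" using m(3) by linarith
    then have "1/2 \<le> \<bar>Re (z - of_nat k)\<bar>" by simp
    then have "1/2 \<le> norm (z - of_nat k)" using abs_Re_le_cmod order_trans by blast
    moreover have "c * real n \<le> norm (z + of_nat k)"
      using Rez complex_Re_le_cmod[of "z + of_nat k"] by simp
    ultimately have "1/2 * (c * real n) \<le> norm (z - of_nat k) * norm (z + of_nat k)"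
      using c by (intro mult_mono) auto
    also have "\<dots> = norm (a k)"
      by (simp add: a_def power2_eq_square algebra_simps flip: norm_mult)
    finally show ?thesis by simp
  qed
  have r1: "norm (r - 1) \<le> E - 1"
  proof -
    have near_1: "norm (stirling_quotient v - 1) \<le> exp (1 / (c * real n)) - 1"
      if v: "c * real n \<le> Re v" for v
    proof -
      have "norm (stirling_quotient v - 1) \<le> exp (1 / Re v) - 1"
        using v n by (intro complex_stirling) simp
      also have "1 / Re v \<le> 1 / (c * real n)" using v n by (intro divide_left_mono) auto
      finally show ?thesis by simp
    qed
    have "norm (r - 1) \<le> (1 + (exp (1 / (c * real n)) - 1))\<^sup>2 - 1"
      unfolding r_def using Rez by (intro norm_mult_minus_1_le near_1) auto
    also have "(1 + (exp (1 / (c * real n)) - 1))\<^sup>2 = E"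
      by (simp add: E_def power2_eq_square flip: exp_add)
    finally show ?thesis .
  qed
  have E1: "1 \<le> E" using order_trans[OF norm_ge_zero r1] by simp
  have r: "norm r \<le> E" using r1 norm_triangle_ineq[of "r - 1" 1] by simp
  have Gamma_eq: "(-1) ^ (n - 1) * z * Gamma (of_nat n + z) * Gamma (of_nat n - z) / of_real pi = M * r"
    unfolding M_def r_def z_def s_def
    using n0 s c unfolding s_def by (intro pi_prefactor_conv_Gamma) linarith+
  have prod_eq: "(\<Prod>k<n. a k) = M * r * sin w"
    unfolding a_def prod_square_diff_eq_Gamma_sin[OF abs_Rez] Gamma_eq[symmetric] wz by simp
  have Qa: "Q * norm (a m) \<le> norm M * (E * W)"
  proof -
    have "Q * norm (a m) = norm (\<Prod>k<n. a k)"
      unfolding Q_def using m by (subst prod.remove[of _ m]) (auto simp: norm_mult prod_norm)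
    also have "\<dots> = norm M * (norm r * norm (sin w))" by (simp add: prod_eq norm_mult)
    also have "\<dots> \<le> norm M * (E * W)"
      using r W by (intro mult_left_mono mult_mono) (auto intro: order_trans[OF norm_ge_zero])
    finally show ?thesis .
  qed
  have Q: "Q \<le> 4 * norm M * (E * W)"
  proof -
    have Q0: "0 \<le> Q" unfolding Q_def by (intro prod_nonneg) auto
    have "1 \<le> norm (z + of_nat m)"
      using complex_Re_le_cmod[of "z + of_nat m"] Rez n by simp
    then have "Q * 1 \<le> Q * norm (z + of_nat m)" using Q0 by (intro mult_left_mono)
    also have "\<dots> \<le> norm (z * Gamma (of_nat n + z) * Gamma (of_nat n - z)) * exp (pi * \<bar>Im z\<bar>)"
      unfolding Q_def a_def using m abs_Rez by (intro prod_square_diff_omit_le)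
    also have "norm (z * Gamma (of_nat n + z) * Gamma (of_nat n - z)) = pi * norm (M * r)"
      unfolding Gamma_eq[symmetric] by (simp add: norm_mult norm_divide norm_power)
    also have "\<dots> * exp (pi * \<bar>Im z\<bar>) = pi * (norm M * (norm r * exp (pi * \<bar>Im z\<bar>)))"
      by (simp add: norm_mult)
    also have "\<dots> \<le> 4 * (norm M * (E * W))"
      using r W pi_less_4
      by (intro mult_mono mult_left_mono) (auto intro: order_trans[OF norm_ge_zero])
    finally show ?thesis by simp
  qed
  have \<kappa>0: "0 \<le> \<kappa>" using c by (simp add: \<kappa>_def)
  have \<kappa>: "real n / (2 * (c * real n / 2)\<^sup>2) + 1 / (c * real n / 2) = \<kappa>"
    using n0 c by (simp add: \<kappa>_def power2_eq_square field_simps)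
  have "norm (poly (pi_poly n) (z\<^sup>2) - (\<Prod>k<n. a k)) \<le> Q * ((norm (a m) + 1) * \<kappa>)"
    unfolding Q_def \<kappa>[symmetric]
  proof (rule perturbed_product_bound[where v = "\<lambda>k. poly (pi_poly k) (z\<^sup>2)"])
    show "real n / (2 * (c * real n / 2)\<^sup>2) + 1 / (c * real n / 2) \<le> 1"
      unfolding \<kappa> using small by (simp add: \<kappa>_def)
    show "0 < c * real n / 2" using c n0 by simp
  qed (use m big poly_pi_poly_rec in \<open>auto simp: a_def\<close>)
  also have "\<dots> = (Q * norm (a m) + Q) * \<kappa>" by (simp add: algebra_simps)
  also have "\<dots> \<le> (norm M * (E * W) + 4 * norm M * (E * W)) * \<kappa>"
    using Qa Q \<kappa>0 by (intro mult_right_mono add_mono)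
  finally have 1: "norm (poly (pi_poly n) (z\<^sup>2) - (\<Prod>k<n. a k)) \<le> norm M * (5 * E * \<kappa> * W)"
    by (simp add: algebra_simps)
  have "norm ((\<Prod>k<n. a k) - M * sin w) = norm M * (norm (r - 1) * norm (sin w))"
    by (simp add: prod_eq algebra_simps flip: norm_mult)
  also have "\<dots> \<le> norm M * ((E - 1) * W)"
    using r1 E1 W by (intro mult_left_mono mult_mono) (auto intro: order_trans[OF norm_ge_zero])
  finally have 2: "norm ((\<Prod>k<n. a k) - M * sin w) \<le> norm M * ((E - 1) * W)" .
  have "norm (poly (pi_poly n) (z\<^sup>2) - M * sin w)
      \<le> norm M * (5 * E * \<kappa> * W) + norm M * ((E - 1) * W)"
    using norm_triangle_ineq[of "poly (pi_poly n) (z\<^sup>2) - (\<Prod>k<n. a k)" "(\<Prod>k<n. a k) - M * sin w"] 1 2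
    by simp
  also have "\<dots> = norm M * ((E - 1 + 5 * E * \<kappa>) * W)" by (simp add: algebra_simps)
  finally show ?thesis
    unfolding z2 M_def E_def \<kappa>_def W_def .
qed

theorem theorem4p2:
  fixes \<delta> :: real
  assumes "0 < \<delta>" and "\<delta> < 1/2"
  shows "\<exists>(U :: complex set) (\<epsilon>1 :: nat \<Rightarrow> complex \<Rightarrow> complex) (\<epsilon>2 :: nat \<Rightarrow> complex \<Rightarrow> complex).
           open U \<and> complex_of_real ` {\<delta>..1 - \<delta>} \<subseteq> U
         \<and> uniform_limit U \<epsilon>1 (\<lambda>_. 0) sequentially
         \<and> uniform_limit U \<epsilon>2 (\<lambda>_. 0) sequentially
         \<and> (\<forall>y\<in>U. \<forall>n\<ge>1.
              poly (pi_poly n) ((of_nat n)\<^sup>2 * y) =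
                pi_prefactor n y *
                ((1 + \<epsilon>1 n y) * sin (of_nat n * of_real pi * csqrt y)
                 + \<epsilon>2 n y * cos (of_nat n * of_real pi * csqrt y)))"
proof -
  define c where "c = min (sqrt \<delta>) (1 - sqrt (1 - \<delta>)) / 2"
  \<comment> \<open>With this \<open>c\<close>, the square roots of \<open>\<delta>\<close> and \<open>1 - \<delta>\<close> keep distance \<open>c\<close> from the ends of the strip
    that defines \<open>U\<close>.\<close>
  define U where "U = csqrt -` {s. c < Re s \<and> Re s < 1 - c} \<inter> - \<real>\<^sub>\<le>\<^sub>0"
  define w where "w = (\<lambda>n y. of_nat n * of_real pi * csqrt y)"
  define W where "W = (\<lambda>n y. norm (sin (w n y)) + norm (cos (w n y)))"
  define e where "e = (\<lambda>n y. poly (pi_poly n) ((of_nat n)\<^sup>2 * y) / pi_prefactor n y - sin (w n y))"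
  \<comment> \<open>Distributing the relative error \<open>e\<close> in this way makes \<open>\<epsilon>1 sin w + \<epsilon>2 cos w = e\<close>, because
    \<open>cnj (sgn x) x = norm x\<close>, and bounds both coefficients by \<open>norm e / W\<close>.\<close>
  define \<epsilon>1 where "\<epsilon>1 = (\<lambda>n y. e n y * cnj (sgn (sin (w n y))) / of_real (W n y))"
  define \<epsilon>2 where "\<epsilon>2 = (\<lambda>n y. e n y * cnj (sgn (cos (w n y))) / of_real (W n y))"
  define \<eta> where "\<eta> = (\<lambda>n. exp (2 / (c * real n)) - 1
      + 5 * exp (2 / (c * real n)) * (2 / (c\<^sup>2 * real n) + 2 / (c * real n)))"
  have sqrt_less: "sqrt (1 - \<delta>) < 1" "0 < sqrt \<delta>" using assms by auto
  have c: "0 < c" "2 * c \<le> sqrt \<delta>" "2 * c \<le> 1 - sqrt (1 - \<delta>)"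
    using sqrt_less by (auto simp: c_def)
  have "open {s. c < Re s \<and> Re s < 1 - c}"
    by (intro open_Collect_conj open_Collect_less continuous_intros)
  moreover have "open (- \<real>\<^sub>\<le>\<^sub>0 :: complex set)" by (simp add: open_Compl)
  ultimately have open_U: "open U"
    unfolding U_def using continuous_on_open_vimage continuous_on_csqrt by metis
  have segment: "complex_of_real ` {\<delta>..1 - \<delta>} \<subseteq> U"
  proof
    fix v assume "v \<in> complex_of_real ` {\<delta>..1 - \<delta>}"
    then obtain x where v: "v = complex_of_real x" and x: "\<delta> \<le> x" "x \<le> 1 - \<delta>" by auto
    have "csqrt (of_real x) = of_real (sqrt x)" using x assms by simp
    moreover have "sqrt \<delta> \<le> sqrt x" "sqrt x \<le> sqrt (1 - \<delta>)" using x by auto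
    moreover from this have "c < sqrt x" "sqrt x < 1 - c" using c by linarith+
    ultimately show "v \<in> U"
      using x assms by (simp add: U_def v complex_nonpos_Reals_iff)
  qed
  have W_pos: "0 < W n y" for n y
  proof -
    have "sin (w n y) \<noteq> 0 \<or> cos (w n y) \<noteq> 0" using sin_cos_squared_add[of "w n y"] by force
    then show ?thesis by (auto simp: W_def intro: add_pos_nonneg add_nonneg_pos)
  qed
  have prefactor: "pi_prefactor n y \<noteq> 0" if "y \<in> U" "1 \<le> n" for n y
  proof -
    have "c < Re (csqrt y)" "Re (csqrt y) < 1 - c" using that unfolding U_def by blast+
    then have s: "0 < Re (csqrt y)" "Re (csqrt y) < 1" using c by linarith+
    have "1 + v \<noteq> 0 \<and> 1 - v \<noteq> 0" if "0 < Re v" "Re v < 1" for v :: complex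
      using that by (auto simp: complex_eq_iff)
    from this[OF s] have "1 + csqrt y \<noteq> 0" "1 - csqrt y \<noteq> 0" by auto
    moreover from this have "y \<noteq> 0" "y \<noteq> 1" using s by auto
    moreover note that
    ultimately have "(1 + csqrt y) / (1 - csqrt y) \<noteq> 0" "y \<noteq> 0" "1 - y \<noteq> 0"
      "of_nat n / exp 1 \<noteq> (0 :: complex)" by auto
    then show ?thesis by (simp add: pi_prefactor_def)
  qed
  have bound: "\<forall>\<^sub>F n in sequentially. \<forall>y\<in>U. norm (e n y) \<le> \<eta> n * W n y"
  proof -
    have "\<forall>\<^sub>F n in sequentially. 1 \<le> c * real n"
      "\<forall>\<^sub>F n in sequentially. 2 / (c\<^sup>2 * real n) + 2 / (c * real n) \<le> 1"
      using c by real_asymp+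
    then show ?thesis using eventually_ge_at_top[of 1]
    proof eventually_elim
      case (elim n)
      show ?case
      proof
        fix y assume y: "y \<in> U"
        have "norm (poly (pi_poly n) ((of_nat n)\<^sup>2 * y) - pi_prefactor n y * sin (w n y))
            \<le> norm (pi_prefactor n y) * (\<eta> n * W n y)"
          unfolding w_def W_def \<eta>_def using y c elim by (intro pi_poly_approx) (simp_all add: U_def del: csqrt.simps)
        moreover have "poly (pi_poly n) ((of_nat n)\<^sup>2 * y) - pi_prefactor n y * sin (w n y)
            = pi_prefactor n y * e n y"
          using prefactor[OF y elim(3)] by (simp add: e_def algebra_simps)
        ultimately show "norm (e n y) \<le> \<eta> n * W n y"
          using prefactor[OF y elim(3)] by (simp add: norm_mult)
      qed
    qed
  qed
  have \<eta>: "\<eta> \<longlonglongrightarrow> 0" unfolding \<eta>_def using c by real_asymp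
  have uniform: "uniform_limit U (\<lambda>n y. e n y * cnj (sgn (t n y)) / of_real (W n y)) (\<lambda>_. 0) sequentially"
    for t :: "nat \<Rightarrow> complex \<Rightarrow> complex"
  proof (rule uniform_limitI)
    fix d :: real assume "0 < d"
    then have "\<forall>\<^sub>F n in sequentially. \<eta> n < d" using order_tendstoD(2)[OF \<eta>] by blast
    with bound show "\<forall>\<^sub>F n in sequentially. \<forall>y\<in>U. dist (e n y * cnj (sgn (t n y)) / of_real (W n y)) 0 < d"
    proof eventually_elim
      case (elim n)
      show ?case
      proof
        fix y assume y: "y \<in> U"
        have "norm (e n y * cnj (sgn (t n y)) / of_real (W n y)) \<le> norm (e n y) / W n y"
          using W_pos[of n y] by (auto simp: norm_mult norm_divide norm_sgn)
        also have "\<dots> \<le> \<eta> n" using elim(1) y W_pos[of n y] by (auto simp: field_simps)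
        finally show "dist (e n y * cnj (sgn (t n y)) / of_real (W n y)) 0 < d" using elim(2) by simp
      qed
    qed
  qed
  have "poly (pi_poly n) ((of_nat n)\<^sup>2 * y) = pi_prefactor n y *
      ((1 + \<epsilon>1 n y) * sin (w n y) + \<epsilon>2 n y * cos (w n y))" if "y \<in> U" "1 \<le> n" for n y
  proof -
    have unit: "cnj (sgn x) * x = of_real (norm x)" for x :: complex
    proof (cases "x = 0")
      case False
      have "cnj (sgn x) * x = (x * cnj x) / of_real (norm x)" by (simp add: sgn_eq mult.commute)
      also have "x * cnj x = (of_real (norm x))\<^sup>2" by (simp flip: complex_norm_square)
      finally show ?thesis using False by (simp add: power2_eq_square)
    qed simp
    have "\<epsilon>1 n y * sin (w n y) + \<epsilon>2 n y * cos (w n y)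
       = e n y * (cnj (sgn (sin (w n y))) * sin (w n y) + cnj (sgn (cos (w n y))) * cos (w n y)) / of_real (W n y)"
      by (simp add: \<epsilon>1_def \<epsilon>2_def add_divide_distrib algebra_simps)
    also have "\<dots> = e n y" unfolding unit using W_pos[of n y] by (simp add: W_def flip: of_real_add)
    finally have "(1 + \<epsilon>1 n y) * sin (w n y) + \<epsilon>2 n y * cos (w n y) = sin (w n y) + e n y"
      by (simp add: algebra_simps)
    then show ?thesis using prefactor[OF that] by (simp add: e_def)
  qed
  then have "\<forall>y\<in>U. \<forall>n\<ge>1. poly (pi_poly n) ((of_nat n)\<^sup>2 * y) = pi_prefactor n y *
      ((1 + \<epsilon>1 n y) * sin (of_nat n * of_real pi * csqrt y)
       + \<epsilon>2 n y * cos (of_nat n * of_real pi * csqrt y))"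
    by (simp only: w_def) simp
  moreover have "uniform_limit U \<epsilon>1 (\<lambda>_. 0) sequentially" "uniform_limit U \<epsilon>2 (\<lambda>_. 0) sequentially"
    unfolding \<epsilon>1_def \<epsilon>2_def by (rule uniform)+
  ultimately show ?thesis
    using open_U segment by (intro exI[of _ U] exI[of _ \<epsilon>1] exI[of _ \<epsilon>2] conjI)
qed

end
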